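(* Let $n\ge2$, let $\mathbf u_1,\ldots,\mathbf u_n$ be nonzero mutually perpendicular vectors in $\mathbb R^n$, and put $\mathbf v=\sum_{i=1}^{n}\mathbf u_i$. For every real $t$, $$\sum_{i=1}^{n}\frac{\bigl\lVert\,\lVert\mathbf u_i\rVert^{2}\mathbf v+t\lVert\mathbf v\rVert^{2}\mathbf u_i\bigr\rVert^{2}}{\lVert\mathbf u_i\rVert^{2}}=(nt^2+2t+1)\lVert\mathbf v\rVert^4,$$ and consequently $$\sum_{i=1}^{n}\bigl\lVert\,\lVert\mathbf u_i\rVert^{2}\mathbf v+t\lVert\mathbf v\rVert^{2}\mathbf u_i\bigr\rVert\le\sqrt{nt^2+2t+1}\,\lVert\mathbf v\rVert^3.$$ For $t=0$, equality in the last inequality holds for every such configuration. For $t\ne0$, equality holds if and only if $\lVert\mathbf u_1\rVert=\cdots=\lVert\mathbf u_n\rVert$. Hence the constant $\sqrt{nt^2+2t+1}$ is best possible for every $t$.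
   Context: $\lVert\cdot\rVert$ is the Euclidean norm. *)

theory Defs
  imports "HOL-Analysis.Analysis"
begin

text \<open>Only the values of \<open>u\<close> on \<open>{1..n}\<close> matter. Perpendicularity is required of the family, not
  of the set of its members, so repeated vectors are excluded.\<close>

definition perpendicular_system :: "nat \<Rightarrow> (nat \<Rightarrow> 'a::real_inner) \<Rightarrow> bool" where
  "perpendicular_system n u \<longleftrightarrow>
     (\<forall>i\<in>{1..n}. u i \<noteq> 0) \<and> pairwise (\<lambda>i j. orthogonal (u i) (u j)) {1..n}"

end

theory Submission
  imports Defs
begin

text \<open>
  Write \<open>a\<^sub>i\<close> for the square of the norm of \<open>u\<^sub>i\<close>, \<open>A\<close> for the square of the norm of \<open>v\<close>, and
  \<open>w\<^sub>i = a\<^sub>i v + t A u\<^sub>i\<close>. By perpendicularity \<open>\<langle>v, u\<^sub>i\<rangle> = a\<^sub>i\<close>, and by Pythagoras the \<open>a\<^sub>i\<close> add up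
  to \<open>A\<close>. Expanding the square gives \<open>\<parallel>w\<^sub>i\<parallel>\<^sup>2 / a\<^sub>i = A ((1 + 2t) a\<^sub>i + t\<^sup>2 A)\<close>, and summation over \<open>i\<close>
  yields the identity.

  The inequality is the Cauchy--Schwarz inequality in the form
  \<open>(\<Sum> x\<^sub>i)\<^sup>2 \<le> (\<Sum> a\<^sub>i) (\<Sum> x\<^sub>i\<^sup>2 / a\<^sub>i)\<close> with \<open>x\<^sub>i = \<parallel>w\<^sub>i\<parallel>\<close>. It says that the variance of the ratios
  \<open>x\<^sub>i / a\<^sub>i\<close>, taken with weights \<open>a\<^sub>i\<close>, is nonnegative, so equality means that these ratios are
  all the same. Here \<open>(x\<^sub>i / a\<^sub>i)\<^sup>2 = A (1 + 2t + t\<^sup>2 A / a\<^sub>i)\<close>: this does not depend on \<open>i\<close> when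
  \<open>t = 0\<close>, and determines \<open>a\<^sub>i\<close> when \<open>t \<noteq> 0\<close>. An orthonormal basis attains equality for every
  \<open>t\<close>, and so no smaller constant will do.
\<close>

section \<open>The weighted Cauchy--Schwarz inequality and its equality case\<close>

text \<open>The last sum is the variance of the ratios \<open>x i / a i\<close> with weights \<open>a i\<close>, up to
  normalisation: their weighted mean is \<open>sum x I / sum a I\<close>. The identity is the usual
  ``mean of the squares minus square of the mean'', cleared of denominators.\<close>

lemma weighted_variance_identity:
  fixes a x :: "'i \<Rightarrow> real"
  assumes fin: "finite I" and pos: "\<forall>i\<in>I. a i > 0"
  shows "sum a I * (\<Sum>i\<in>I. (x i)\<^sup>2 / a i)
       = (sum x I)\<^sup>2 + sum a I * (\<Sum>i\<in>I. a i * (x i / a i - sum x I / sum a I)\<^sup>2)"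
proof (cases "I = {}")
  case True
  then show ?thesis by simp
next
  case False
  define A S where "A = sum a I" and "S = sum x I"
  have A: "A > 0"
    unfolding A_def using fin False pos by (simp add: sum_pos)
  have "(\<Sum>i\<in>I. a i * (x i / a i - S / A)\<^sup>2)
      = (\<Sum>i\<in>I. (x i)\<^sup>2 / a i - 2 * (S / A) * x i + (S / A)\<^sup>2 * a i)"
  proof (rule sum.cong)
    fix i assume "i \<in> I"
    then have "a i \<noteq> 0" using pos by fastforce
    then show "a i * (x i / a i - S / A)\<^sup>2 = (x i)\<^sup>2 / a i - 2 * (S / A) * x i + (S / A)\<^sup>2 * a i"
      by (simp add: power2_diff power_divide power2_eq_square[of "a i"] algebra_simps)
  qed simp
  also have "\<dots> = (\<Sum>i\<in>I. (x i)\<^sup>2 / a i) - 2 * (S / A) * S + (S / A)\<^sup>2 * A"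
    unfolding sum.distrib sum_subtractf sum_distrib_left[symmetric]
    by (simp add: A_def S_def)
  also have "\<dots> = (\<Sum>i\<in>I. (x i)\<^sup>2 / a i) - S\<^sup>2 / A"
    using A by (simp add: power2_eq_square field_simps)
  finally have "(\<Sum>i\<in>I. (x i)\<^sup>2 / a i) = S\<^sup>2 / A + (\<Sum>i\<in>I. a i * (x i / a i - S / A)\<^sup>2)"
    by simp
  then show ?thesis
    unfolding A_def[symmetric] S_def[symmetric] using A by (simp add: distrib_left)
qed

lemma weighted_Cauchy_Schwarz:
  fixes a x :: "'i \<Rightarrow> real"
  assumes fin: "finite I" and pos: "\<forall>i\<in>I. a i > 0"
  shows "(sum x I)\<^sup>2 \<le> sum a I * (\<Sum>i\<in>I. (x i)\<^sup>2 / a i)"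
proof -
  have "0 \<le> sum a I * (\<Sum>i\<in>I. a i * (x i / a i - sum x I / sum a I)\<^sup>2)"
    by (intro mult_nonneg_nonneg sum_nonneg zero_le_power2 less_imp_le[OF pos[rule_format]])
  then show ?thesis
    using weighted_variance_identity[OF assms, of x] by linarith
qed

lemma weighted_Cauchy_Schwarz_eq_iff:
  fixes a x :: "'i \<Rightarrow> real"
  assumes fin: "finite I" and pos: "\<forall>i\<in>I. a i > 0"
  shows "(sum x I)\<^sup>2 = sum a I * (\<Sum>i\<in>I. (x i)\<^sup>2 / a i)
     \<longleftrightarrow> (\<forall>i\<in>I. \<forall>j\<in>I. x i / a i = x j / a j)"
proof (cases "I = {}")
  case True
  then show ?thesis by simp
next
  case False
  have A: "sum a I > 0"
    using fin False pos by (simp add: sum_pos)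
  have "(sum x I)\<^sup>2 = sum a I * (\<Sum>i\<in>I. (x i)\<^sup>2 / a i)
     \<longleftrightarrow> (\<Sum>i\<in>I. a i * (x i / a i - sum x I / sum a I)\<^sup>2) = 0"
    using weighted_variance_identity[OF assms, of x] A by auto
  also have "\<dots> \<longleftrightarrow> (\<forall>i\<in>I. a i * (x i / a i - sum x I / sum a I)\<^sup>2 = 0)"
    by (intro sum_nonneg_eq_0_iff fin mult_nonneg_nonneg zero_le_power2 less_imp_le[OF pos[rule_format]])
  also have "\<dots> \<longleftrightarrow> (\<forall>i\<in>I. x i / a i = sum x I / sum a I)"
    using pos by force
  also have "\<dots> \<longleftrightarrow> (\<forall>i\<in>I. \<forall>j\<in>I. x i / a i = x j / a j)"
  proof
    assume const: "\<forall>i\<in>I. \<forall>j\<in>I. x i / a i = x j / a j"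
    show "\<forall>i\<in>I. x i / a i = sum x I / sum a I"
    proof
      fix i assume i: "i \<in> I"
      have "sum x I = (\<Sum>j\<in>I. x i / a i * a j)"
      proof (rule sum.cong)
        fix j assume j: "j \<in> I"
        then have "x i / a i = x j / a j" and "a j \<noteq> 0"
          using const i pos by fastforce+
        then show "x j = x i / a i * a j" by simp
      qed simp
      also have "\<dots> = x i / a i * sum a I"
        by (rule sum_distrib_left[symmetric])
      finally show "x i / a i = sum x I / sum a I"
        using A by simp
    qed
  qed simp
  finally show ?thesis .
qed

section \<open>Perpendicular systems\<close>

lemma inner_sum_pairwise_orthogonal:
  assumes "finite I" "i \<in> I" and orth: "pairwise (\<lambda>i j. orthogonal (u i) (u j)) I"
  shows "sum u I \<bullet> u i = (norm (u i))\<^sup>2"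
proof -
  have "sum u I \<bullet> u i = u i \<bullet> u i + (\<Sum>j\<in>I - {i}. u j \<bullet> u i)"
    unfolding inner_sum_left by (rule sum.remove[OF assms(1,2)])
  also have "(\<Sum>j\<in>I - {i}. u j \<bullet> u i) = 0"
    using orth assms(2) by (intro sum.neutral) (auto simp: pairwise_def orthogonal_def)
  finally show ?thesis
    by (simp add: power2_norm_eq_inner)
qed

text \<open>Expanding the square, each of the three terms contains the factor \<open>\<parallel>u\<parallel>\<^sup>2 \<parallel>v\<parallel>\<^sup>2\<close>. What
  remains is affine in \<open>\<parallel>u\<parallel>\<^sup>2\<close>, so that division by \<open>\<parallel>u\<parallel>\<^sup>2\<close> leaves something that can be
  summed over a perpendicular system by Pythagoras.\<close>

lemma norm_mixed_vector_squared:
  fixes u v :: "'a::real_inner"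
  assumes "v \<bullet> u = (norm u)\<^sup>2"
  shows "(norm ((norm u)\<^sup>2 *\<^sub>R v + (t * (norm v)\<^sup>2) *\<^sub>R u))\<^sup>2
       = (norm u)\<^sup>2 * ((norm v)\<^sup>2 * ((1 + 2 * t) * (norm u)\<^sup>2 + t\<^sup>2 * (norm v)\<^sup>2))"
proof -
  define a A where "a = (norm u)\<^sup>2" and "A = (norm v)\<^sup>2"
  have "u \<bullet> u = a" "v \<bullet> v = A" "v \<bullet> u = a" "u \<bullet> v = a"
    using assms by (simp_all add: a_def A_def power2_norm_eq_inner inner_commute)
  then have "(norm (a *\<^sub>R v + (t * A) *\<^sub>R u))\<^sup>2 = a * (A * ((1 + 2 * t) * a + t\<^sup>2 * A))"
    unfolding power2_norm_eq_inner
    by (simp add: inner_add_left inner_add_right power2_eq_square algebra_simps)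
  then show ?thesis
    by (simp add: a_def A_def)
qed

lemma quadratic_factor_nonneg:
  fixes t :: real
  assumes "n \<ge> 1"
  shows "0 \<le> real n * t\<^sup>2 + 2 * t + 1"
proof -
  have "1 * t\<^sup>2 \<le> real n * t\<^sup>2"
    using assms by (intro mult_right_mono) auto
  moreover have "0 \<le> (t + 1)\<^sup>2" by simp
  ultimately show ?thesis by (simp add: power2_eq_square algebra_simps)
qed

text \<open>The configuration enters only through the numbers \<open>a i\<close> and their sum \<open>A\<close>: once \<open>\<parallel>w i\<parallel>\<^sup>2\<close> is
  expressed in them, the identity is a summation and the rest is the weighted Cauchy--Schwarz
  inequality with weights \<open>a i\<close>.\<close>

lemma perpendicular_system_mixed_sums:
  fixes u :: "nat \<Rightarrow> 'a::real_inner" and t :: real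
  assumes ps: "perpendicular_system n u" and n: "n \<ge> 1"
  defines "v \<equiv> \<Sum>i=1..n. u i"
  defines "w \<equiv> \<lambda>i. (norm (u i))\<^sup>2 *\<^sub>R v + (t * (norm v)\<^sup>2) *\<^sub>R u i"
  defines "B \<equiv> sqrt (real n * t\<^sup>2 + 2 * t + 1) * norm v ^ 3"
  shows "norm v > 0"
    and "(\<Sum>i=1..n. (norm (w i))\<^sup>2 / (norm (u i))\<^sup>2) = (real n * t\<^sup>2 + 2 * t + 1) * norm v ^ 4"
    and "(\<Sum>i=1..n. norm (w i)) \<le> B"
    and "(\<Sum>i=1..n. norm (w i)) = B
     \<longleftrightarrow> t = 0 \<or> (\<forall>i\<in>{1..n}. \<forall>j\<in>{1..n}. norm (u i) = norm (u j))"
proof -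
  define K where "K = real n * t\<^sup>2 + 2 * t + 1"
  define a where "a = (\<lambda>i. (norm (u i))\<^sup>2)"
  define A where "A = (norm v)\<^sup>2"
  have K: "K \<ge> 0"
    unfolding K_def by (rule quadratic_factor_nonneg[OF n])
  have orth: "pairwise (\<lambda>i j. orthogonal (u i) (u j)) {1..n}"
    and apos: "\<And>i. i \<in> {1..n} \<Longrightarrow> a i > 0"
    using ps by (auto simp: perpendicular_system_def a_def)
  have sum_a: "sum a {1..n} = A"
    using norm_sum_Pythagorean[OF _ orth] by (simp add: a_def A_def v_def)
  have Apos: "A > 0"
    unfolding sum_a[symmetric] using n apos by (intro sum_pos) auto
  then show "norm v > 0"
    by (simp add: A_def)
  have w2: "(norm (w i))\<^sup>2 = a i * (A * ((1 + 2 * t) * a i + t\<^sup>2 * A))" if "i \<in> {1..n}" for i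
    unfolding w_def a_def A_def v_def
    using that orth by (intro norm_mixed_vector_squared inner_sum_pairwise_orthogonal) auto
  have "(\<Sum>i=1..n. (norm (w i))\<^sup>2 / a i) = (\<Sum>i=1..n. A * (1 + 2 * t) * a i + A\<^sup>2 * t\<^sup>2)"
  proof (rule sum.cong)
    fix i assume i: "i \<in> {1..n}"
    show "(norm (w i))\<^sup>2 / a i = A * (1 + 2 * t) * a i + A\<^sup>2 * t\<^sup>2"
      unfolding w2[OF i] using apos[OF i] by (simp add: power2_eq_square field_simps)
  qed simp
  also have "\<dots> = A * (1 + 2 * t) * A + real n * (A\<^sup>2 * t\<^sup>2)"
    unfolding sum.distrib sum_distrib_left[symmetric] sum_a by simp
  also have "\<dots> = K * A\<^sup>2"
    by (simp add: K_def power2_eq_square algebra_simps)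
  finally have weighted: "(\<Sum>i=1..n. (norm (w i))\<^sup>2 / a i) = K * A\<^sup>2" .
  then show "(\<Sum>i=1..n. (norm (w i))\<^sup>2 / (norm (u i))\<^sup>2) = (real n * t\<^sup>2 + 2 * t + 1) * norm v ^ 4"
    by (simp add: a_def A_def K_def flip: power_mult)

  have B: "B \<ge> 0"
    using K by (simp add: B_def K_def)
  have "B\<^sup>2 = K * (norm v ^ 3)\<^sup>2"
    using K by (simp add: B_def K_def power_mult_distrib)
  also have "\<dots> = A * (K * A\<^sup>2)"
    by (simp add: A_def eval_nat_numeral algebra_simps)
  finally have B2: "B\<^sup>2 = A * (K * A\<^sup>2)" .
  have S: "(\<Sum>i=1..n. norm (w i)) \<ge> 0"
    by (simp add: sum_nonneg)
  have "(\<Sum>i=1..n. norm (w i))\<^sup>2 \<le> B\<^sup>2"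
    using weighted_Cauchy_Schwarz[of "{1..n}" a "\<lambda>i. norm (w i)"] apos
    unfolding sum_a weighted B2 by simp
  then show "(\<Sum>i=1..n. norm (w i)) \<le> B"
    using B by (rule power2_le_imp_le)

  have ratio: "norm (w i) / a i = norm (w j) / a j \<longleftrightarrow> t = 0 \<or> norm (u i) = norm (u j)"
    if i: "i \<in> {1..n}" and j: "j \<in> {1..n}" for i j
  proof -
    have ratio2: "(norm (w k) / a k)\<^sup>2 = A * (1 + 2 * t) + (t * A)\<^sup>2 / a k"
      if k: "k \<in> {1..n}" for k
      unfolding power_divide w2[OF k] using apos[OF k]
      by (simp add: power2_eq_square divide_simps) (simp add: algebra_simps)
    have "norm (w i) / a i = norm (w j) / a j
      \<longleftrightarrow> (norm (w i) / a i)\<^sup>2 = (norm (w j) / a j)\<^sup>2"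
      by (rule power2_eq_iff_nonneg[symmetric]) (simp_all add: a_def)
    also have "\<dots> \<longleftrightarrow> (t * A)\<^sup>2 / a i = (t * A)\<^sup>2 / a j"
      unfolding ratio2[OF i] ratio2[OF j] by simp
    also have "\<dots> \<longleftrightarrow> t = 0 \<or> a i = a j"
      using apos[OF i] apos[OF j] Apos by (auto simp: divide_simps)
    also have "\<dots> \<longleftrightarrow> t = 0 \<or> norm (u i) = norm (u j)"
      by (simp add: a_def power2_eq_iff_nonneg)
    finally show ?thesis .
  qed
  have "(\<Sum>i=1..n. norm (w i)) = B \<longleftrightarrow> (\<Sum>i=1..n. norm (w i))\<^sup>2 = B\<^sup>2"
    using S B by (simp add: power2_eq_iff_nonneg)
  also have "\<dots> \<longleftrightarrow> (\<forall>i\<in>{1..n}. \<forall>j\<in>{1..n}. norm (w i) / a i = norm (w j) / a j)"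
    using weighted_Cauchy_Schwarz_eq_iff[of "{1..n}" a "\<lambda>i. norm (w i)"] apos
    unfolding sum_a weighted B2 by simp
  also have "\<dots> \<longleftrightarrow> (\<forall>i\<in>{1..n}. \<forall>j\<in>{1..n}. t = 0 \<or> norm (u i) = norm (u j))"
    by (intro ball_cong refl ratio)
  also have "\<dots> \<longleftrightarrow> t = 0 \<or> (\<forall>i\<in>{1..n}. \<forall>j\<in>{1..n}. norm (u i) = norm (u j))"
    by blast
  finally show "(\<Sum>i=1..n. norm (w i)) = B
     \<longleftrightarrow> t = 0 \<or> (\<forall>i\<in>{1..n}. \<forall>j\<in>{1..n}. norm (u i) = norm (u j))" .
qed

section \<open>Sharpness\<close>

lemma orthonormal_perpendicular_system_exists:
  assumes "CARD('n::finite) = n"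
  obtains u :: "nat \<Rightarrow> real ^ 'n"
  where "perpendicular_system n u" "\<And>i. i \<in> {1..n} \<Longrightarrow> norm (u i) = 1"
proof -
  obtain f where f: "bij_betw f {1..n} (UNIV :: 'n set)"
    using assms finite_same_card_bij[of "{1..n}" "UNIV :: 'n set"] by auto
  define u :: "nat \<Rightarrow> real ^ 'n" where "u = (\<lambda>i. axis (f i) 1)"
  show thesis
  proof (rule that[of u])
    have "f i \<noteq> f j" if "i \<in> {1..n}" "j \<in> {1..n}" "i \<noteq> j" for i j
      using bij_betw_imp_inj_on[OF f] that by (auto dest: inj_onD)
    then show "perpendicular_system n u"
      by (auto simp: perpendicular_system_def u_def pairwise_def orthogonal_def inner_axis_axis
          axis_eq_0_iff)
  qed (simp add: u_def)
qed

theorem theorem7p1: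
  fixes n :: nat and t :: real
  assumes dim: "CARD('n::finite) = n"
    and n: "n \<ge> 2"
  shows "(\<forall>u :: nat \<Rightarrow> real ^ 'n. perpendicular_system n u \<longrightarrow>
           (let v = (\<Sum>i=1..n. u i);
                S = (\<Sum>i=1..n. norm ((norm (u i))\<^sup>2 *\<^sub>R v + (t * (norm v)\<^sup>2) *\<^sub>R u i));
                B = sqrt (real n * t\<^sup>2 + 2 * t + 1) * norm v ^ 3
            in (\<Sum>i=1..n. (norm ((norm (u i))\<^sup>2 *\<^sub>R v + (t * (norm v)\<^sup>2) *\<^sub>R u i))\<^sup>2 / (norm (u i))\<^sup>2)
                 = (real n * t\<^sup>2 + 2 * t + 1) * norm v ^ 4
             \<and> S \<le> B
             \<and> (t = 0 \<longrightarrow> S = B)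
             \<and> (t \<noteq> 0 \<longrightarrow> (S = B \<longleftrightarrow> (\<forall>i\<in>{1..n}. \<forall>j\<in>{1..n}. norm (u i) = norm (u j))))))
       \<and> (\<forall>C :: real.
            (\<forall>u :: nat \<Rightarrow> real ^ 'n. perpendicular_system n u \<longrightarrow>
               (let v = (\<Sum>i=1..n. u i)
                in (\<Sum>i=1..n. norm ((norm (u i))\<^sup>2 *\<^sub>R v + (t * (norm v)\<^sup>2) *\<^sub>R u i)) \<le> C * norm v ^ 3))
            \<longrightarrow> sqrt (real n * t\<^sup>2 + 2 * t + 1) \<le> C)"
proof (intro conjI allI impI)
  fix u :: "nat \<Rightarrow> real ^ 'n"
  assume "perpendicular_system n u"
  moreover have "n \<ge> 1" using n by simp
  ultimately show "let v = (\<Sum>i=1..n. u i);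
                S = (\<Sum>i=1..n. norm ((norm (u i))\<^sup>2 *\<^sub>R v + (t * (norm v)\<^sup>2) *\<^sub>R u i));
                B = sqrt (real n * t\<^sup>2 + 2 * t + 1) * norm v ^ 3
            in (\<Sum>i=1..n. (norm ((norm (u i))\<^sup>2 *\<^sub>R v + (t * (norm v)\<^sup>2) *\<^sub>R u i))\<^sup>2 / (norm (u i))\<^sup>2)
                 = (real n * t\<^sup>2 + 2 * t + 1) * norm v ^ 4
             \<and> S \<le> B
             \<and> (t = 0 \<longrightarrow> S = B)
             \<and> (t \<noteq> 0 \<longrightarrow> (S = B \<longleftrightarrow> (\<forall>i\<in>{1..n}. \<forall>j\<in>{1..n}. norm (u i) = norm (u j))))"
    unfolding Let_def
    using perpendicular_system_mixed_sums(2-4)[of n u t] by blast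
next
  fix C :: real
  assume bound: "\<forall>u :: nat \<Rightarrow> real ^ 'n. perpendicular_system n u \<longrightarrow>
               (let v = (\<Sum>i=1..n. u i)
                in (\<Sum>i=1..n. norm ((norm (u i))\<^sup>2 *\<^sub>R v + (t * (norm v)\<^sup>2) *\<^sub>R u i)) \<le> C * norm v ^ 3)"
  obtain u :: "nat \<Rightarrow> real ^ 'n"
    where ps: "perpendicular_system n u" and unit: "\<And>i. i \<in> {1..n} \<Longrightarrow> norm (u i) = 1"
    using orthonormal_perpendicular_system_exists[OF dim] by blast
  define v where "v = (\<Sum>i=1..n. u i)"
  have n1: "n \<ge> 1" using n by simp
  have "sqrt (real n * t\<^sup>2 + 2 * t + 1) * norm v ^ 3
      = (\<Sum>i=1..n. norm ((norm (u i))\<^sup>2 *\<^sub>R v + (t * (norm v)\<^sup>2) *\<^sub>R u i))"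
    using perpendicular_system_mixed_sums(4)[OF ps n1, of t] unit by (simp add: v_def)
  also have "\<dots> \<le> C * norm v ^ 3"
    using bound ps by (simp add: Let_def v_def)
  finally show "sqrt (real n * t\<^sup>2 + 2 * t + 1) \<le> C"
    using perpendicular_system_mixed_sums(1)[OF ps n1] by (simp add: v_def)
qed

end
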